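(* Let $X$ be a Cayley (di)graph for a group $\Gamma$, and let $X^\bullet$ be the core of $X$. Then every orbital (di)graph of $X^\bullet$ is homomorphically equivalent to a Cayley (di)graph for $\Gamma$.
   Context: All (di)graphs and groups are finite. The Cayley digraph $\mathrm{Cay}(\Gamma,C)$, $C\subseteq\Gamma$, has vertex set $\Gamma$ and an arc from $a$ to $b$ iff $ba^{-1}\in C$; if $C$ is inverse closed and does not contain the identity it is considered as an undirected graph, called a Cayley graph. A homomorphism of (di)graphs is a vertex map preserving adjacency (arcs); two (di)graphs are homomorphically equivalent if each admits a homomorphism to the other. A (di)graph is a core if all its endomorphisms are bijective; the core $X^\bullet$ of $X$ is the unique (up to isomorphism) core homomorphically equivalent to $X$. The orbitals of $\operatorname{Aut}(X^\bullet)$ are its orbits on $V(X^\bullet)\times V(X^\bullet)$; an orbital is diagonal if it consists of pairs $(x,x)$. An orbital digraph of $X^\bullet$ is a digraph with vertex set $V(X^\bullet)$ whose arc set is a union of non-diagonal orbitals of $\operatorname{Aut}(X^\bullet)$; if the arc set is symmetric, it is considered as an undirected graph and called an orbital graph. *)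

theory Defs
  imports "Graph_Theory.Pair_Digraph" "HOL-Algebra.Group_Action"
begin

text \<open>
  Digraphs have no parallel arcs, so they are records of a vertex set and a set of arcs that are
  pairs of vertices.  An undirected graph is identified with the loopless symmetric digraph that
  has both arcs \<open>(u, v)\<close> and \<open>(v, u)\<close> for each edge; graph homomorphisms are then exactly the
  digraph homomorphisms.
\<close>

definition cay :: "('a, 'm) monoid_scheme \<Rightarrow> 'a set \<Rightarrow> 'a pair_pre_digraph" where
  "cay G C =
    \<lparr> pverts = carrier G,
      parcs = {(a, b). a \<in> carrier G \<and> b \<in> carrier G \<and> b \<otimes>\<^bsub>G\<^esub> inv\<^bsub>G\<^esub> a \<in> C} \<rparr>"

text \<open>The connection set of a Cayley digraph may contain the identity (giving loops).\<close>

definition cayley_digraph_for :: "('a, 'm) monoid_scheme \<Rightarrow> 'a pair_pre_digraph \<Rightarrow> bool" where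
  "cayley_digraph_for G X \<longleftrightarrow> (\<exists>C \<subseteq> carrier G. X = cay G C)"

definition cayley_graph_for :: "('a, 'm) monoid_scheme \<Rightarrow> 'a pair_pre_digraph \<Rightarrow> bool" where
  "cayley_graph_for G X \<longleftrightarrow>
    (\<exists>C \<subseteq> carrier G. (\<forall>c \<in> C. inv\<^bsub>G\<^esub> c \<in> C) \<and> \<one>\<^bsub>G\<^esub> \<notin> C \<and> X = cay G C)"

definition digraph_hom ::
  "'a pair_pre_digraph \<Rightarrow> 'b pair_pre_digraph \<Rightarrow> ('a \<Rightarrow> 'b) set" where
  "digraph_hom X Y =
    {f \<in> pverts X \<rightarrow> pverts Y. \<forall>(u, v) \<in> parcs X. (f u, f v) \<in> parcs Y}"

definition hom_equivalent ::
  "'a pair_pre_digraph \<Rightarrow> 'b pair_pre_digraph \<Rightarrow> bool" where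
  "hom_equivalent X Y \<longleftrightarrow> digraph_hom X Y \<noteq> {} \<and> digraph_hom Y X \<noteq> {}"

definition is_core :: "'a pair_pre_digraph \<Rightarrow> bool" where
  "is_core K \<longleftrightarrow>
    pair_fin_digraph K \<and> (\<forall>f \<in> digraph_hom K K. bij_betw f (pverts K) (pverts K))"

text \<open>
  The core of \<open>X\<close> is determined only up to isomorphism, so it is a relation rather than a function,
  and its vertices need not have the type of the vertices of \<open>X\<close>.
\<close>

definition core_of :: "'b pair_pre_digraph \<Rightarrow> 'a pair_pre_digraph \<Rightarrow> bool" where
  "core_of K X \<longleftrightarrow> is_core K \<and> hom_equivalent K X"

definition digraph_auto :: "'a pair_pre_digraph \<Rightarrow> ('a \<Rightarrow> 'a) set" where
  "digraph_auto X =
    {f \<in> Bij (pverts X).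
      \<forall>u \<in> pverts X. \<forall>v \<in> pverts X. (f u, f v) \<in> parcs X \<longleftrightarrow> (u, v) \<in> parcs X}"

definition digraph_AutoGroup :: "'a pair_pre_digraph \<Rightarrow> ('a \<Rightarrow> 'a) monoid" where
  "digraph_AutoGroup X = BijGroup (pverts X) \<lparr>carrier := digraph_auto X\<rparr>"

definition orbitals :: "'a pair_pre_digraph \<Rightarrow> ('a \<times> 'a) set set" where
  "orbitals X =
    orbits (digraph_AutoGroup X) (pverts X \<times> pverts X) (\<lambda>g (x, y). (g x, g y))"

definition diagonal :: "('a \<times> 'a) set \<Rightarrow> bool" where
  "diagonal R \<longleftrightarrow> (\<forall>(x, y) \<in> R. x = y)"

text \<open>The empty union is allowed, so the arcless digraph is an orbital digraph.\<close>

definition orbital_digraph :: "'a pair_pre_digraph \<Rightarrow> 'a pair_pre_digraph \<Rightarrow> bool" where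
  "orbital_digraph X Y \<longleftrightarrow>
    pverts Y = pverts X \<and>
    (\<exists>\<R> \<subseteq> {R \<in> orbitals X. \<not> diagonal R}. parcs Y = \<Union>\<R>)"

definition orbital_graph :: "'a pair_pre_digraph \<Rightarrow> 'a pair_pre_digraph \<Rightarrow> bool" where
  "orbital_graph X Y \<longleftrightarrow> orbital_digraph X Y \<and> sym (parcs Y)"

end

theory Submission
  imports Defs
begin

text \<open>
  Let \<open>X\<close> be a Cayley digraph for \<open>\<Gamma>\<close>, let \<open>K\<close> be its core, and choose homomorphisms
  \<open>\<iota> : K \<rightarrow> X\<close> and \<open>\<phi> : X \<rightarrow> K\<close>.  Right multiplication by \<open>\<gamma> \<in> \<Gamma>\<close> is an endomorphism of \<open>X\<close>, so
  \<open>\<alpha>\<^sub>\<gamma> k = \<phi> (\<iota> k \<gamma>)\<close> is an endomorphism of \<open>K\<close>, and hence an automorphism, because \<open>K\<close> is a core.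

  An orbital digraph \<open>Y\<close> of \<open>K\<close> is a digraph on the vertices of \<open>K\<close> that is invariant under every
  automorphism of \<open>K\<close>.  Pulling \<open>Y\<close> back along \<open>\<phi>\<close> gives a digraph on \<open>\<Gamma>\<close>; let \<open>Z\<close> be the largest
  right-invariant digraph contained in it.  Thus \<open>Z\<close> has an arc from \<open>a\<close> to \<open>b\<close> iff
  \<open>(\<phi> (a \<gamma>), \<phi> (b \<gamma>))\<close> is an arc of \<open>Y\<close> for all \<open>\<gamma>\<close>, and it is the Cayley digraph
  with connection set \<open>{c. \<forall>\<gamma>. (\<phi> \<gamma>, \<phi> (c \<gamma>)) is an arc of Y}\<close>.  By construction \<open>\<phi>\<close> maps \<open>Z\<close> to
  \<open>Y\<close>.  Conversely \<open>\<iota>\<close> maps \<open>Y\<close> to \<open>Z\<close>: for an arc \<open>(u, v)\<close> of \<open>Y\<close> the required arcs are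
  \<open>(\<alpha>\<^sub>\<gamma> u, \<alpha>\<^sub>\<gamma> v)\<close>, and they lie in \<open>Y\<close> by invariance.

  If \<open>Y\<close> is symmetric, then so is \<open>Z\<close>; and \<open>Z\<close> has no loops, since \<open>\<phi>\<close> would map them
  to loops of \<open>Y\<close>, which a union of non-diagonal orbitals does not contain.
\<close>

text \<open>
  A bijective endomorphism acts injectively on the finite set of arcs, hence permutes it, so it
  reflects arcs as well.  Elements of \<^const>\<open>Bij\<close> are extensional, which is why the restriction
  appears.
\<close>

lemma bijective_endomorphism_is_automorphism:
  assumes fin: "pair_fin_digraph K"
    and f: "f \<in> digraph_hom K K" and bij: "bij_betw f (pverts K) (pverts K)"
  shows "restrict f (pverts K) \<in> digraph_auto K"
proof -
  interpret pair_fin_digraph K by (fact fin)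
  have arcs: "parcs K \<subseteq> pverts K \<times> pverts K"
    using in_arcsD1 in_arcsD2 by fastforce
  have inj: "inj_on f (pverts K)"
    using bij by (rule bij_betw_imp_inj_on)
  have "map_prod f f ` parcs K \<subseteq> parcs K"
    using f by (auto simp: digraph_hom_def)
  moreover have "inj_on (map_prod f f) (parcs K)"
    using map_prod_inj_on[OF inj inj] arcs by (rule inj_on_subset)
  ultimately have onto: "map_prod f f ` parcs K = parcs K"
    by (simp add: endo_inj_surj)
  have "(f u, f v) \<in> parcs K \<longleftrightarrow> (u, v) \<in> parcs K"
    if u: "u \<in> pverts K" and v: "v \<in> pverts K" for u v
  proof
    assume "(f u, f v) \<in> parcs K"
    then obtain a b where ab: "(a, b) \<in> parcs K" "f u = f a" "f v = f b"
      using onto by force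
    moreover have "a \<in> pverts K" "b \<in> pverts K"
      using ab(1) arcs by auto
    ultimately have "u = a" "v = b"
      using inj u v by (auto dest: inj_onD)
    then show "(u, v) \<in> parcs K"
      using ab(1) by simp
  next
    assume "(u, v) \<in> parcs K"
    then show "(f u, f v) \<in> parcs K"
      using f by (auto simp: digraph_hom_def)
  qed
  then show ?thesis
    using bij by (simp add: digraph_auto_def Bij_def bij_betw_cong[of _ "restrict f (pverts K)" f])
qed

lemma core_endomorphism_is_automorphism:
  assumes "is_core K" and "f \<in> digraph_hom K K"
  shows "restrict f (pverts K) \<in> digraph_auto K"
  using assms by (simp add: is_core_def bijective_endomorphism_is_automorphism)

lemma digraph_auto_maps_vertices:
  assumes "f \<in> digraph_auto X" and "u \<in> pverts X"
  shows "f u \<in> pverts X"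
  using assms by (auto simp: digraph_auto_def dest: Bij_imp_funcset)

lemma compose_digraph_auto:
  assumes f: "f \<in> digraph_auto X" and h: "h \<in> digraph_auto X"
  shows "compose (pverts X) f h \<in> digraph_auto X"
  using f h digraph_auto_maps_vertices[OF h]
  by (auto simp: digraph_auto_def compose_Bij compose_eq)

lemma orbitals_eq:
  "orbitals X =
    {(\<lambda>h. (h x, h y)) ` digraph_auto X | x y. x \<in> pverts X \<and> y \<in> pverts X}"
  unfolding orbitals_def orbits_def orbit_def digraph_AutoGroup_def by auto

lemma orbital_cases:
  assumes "R \<in> orbitals X"
  obtains x y where "x \<in> pverts X" "y \<in> pverts X" "R = (\<lambda>h. (h x, h y)) ` digraph_auto X"
  using assms unfolding orbitals_eq by blast

lemma orbital_subset_vertices: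
  assumes "R \<in> orbitals X"
  shows "R \<subseteq> pverts X \<times> pverts X"
  using assms by (rule orbital_cases) (auto dest: digraph_auto_maps_vertices)

lemma orbital_invariant:
  assumes R: "R \<in> orbitals X" and f: "f \<in> digraph_auto X" and uv: "(u, v) \<in> R"
  shows "(f u, f v) \<in> R"
proof -
  obtain x y where x: "x \<in> pverts X" and y: "y \<in> pverts X"
    and R_eq: "R = (\<lambda>h. (h x, h y)) ` digraph_auto X"
    using R by (rule orbital_cases)
  obtain h where h: "h \<in> digraph_auto X" and "u = h x" "v = h y"
    using uv R_eq by auto
  then have "(f u, f v) = (\<lambda>h. (h x, h y)) (compose (pverts X) f h)"
    using x y by (simp add: compose_eq)
  then show ?thesis
    unfolding R_eq using compose_digraph_auto[OF f h] by (rule image_eqI)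
qed

text \<open>
  If the images of \<open>x\<close> and \<open>y\<close> under one automorphism coincide, then \<open>x = y\<close>, and so the whole
  orbital of \<open>(x, y)\<close> is diagonal.
\<close>

lemma orbital_with_loop_is_diagonal:
  assumes R: "R \<in> orbitals X" and loop: "(u, u) \<in> R"
  shows "diagonal R"
proof -
  obtain x y where x: "x \<in> pverts X" and y: "y \<in> pverts X"
    and R_eq: "R = (\<lambda>h. (h x, h y)) ` digraph_auto X"
    using R by (rule orbital_cases)
  obtain h where "h \<in> digraph_auto X" "h x = h y"
    using loop R_eq by auto
  then have "x = y"
    using x y by (auto simp: digraph_auto_def Bij_def bij_betw_def dest: inj_onD)
  then show ?thesis
    by (auto simp: R_eq diagonal_def)
qed

lemma orbital_digraph_arcE:
  assumes "orbital_digraph K Y" and "(u, v) \<in> parcs Y"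
  obtains R where "R \<in> orbitals K" "\<not> diagonal R" "(u, v) \<in> R" "R \<subseteq> parcs Y"
proof -
  obtain \<R> where \<R>: "\<R> \<subseteq> {R \<in> orbitals K. \<not> diagonal R}" "parcs Y = \<Union>\<R>"
    using assms(1) unfolding orbital_digraph_def by auto
  then obtain R where "R \<in> \<R>" "(u, v) \<in> R"
    using assms(2) by auto
  with \<R> show thesis
    using that[of R] by auto
qed

lemma orbital_digraph_invariant:
  assumes "orbital_digraph K Y" and "f \<in> digraph_auto K" and "(u, v) \<in> parcs Y"
  shows "(f u, f v) \<in> parcs Y"
  using assms(1,3) by (rule orbital_digraph_arcE) (blast dest: orbital_invariant[OF _ assms(2)])

lemma orbital_digraph_loopless:
  assumes "orbital_digraph K Y"
  shows "(u, u) \<notin> parcs Y"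
  by (blast elim: orbital_digraph_arcE[OF assms] dest: orbital_with_loop_is_diagonal)

lemma orbital_digraph_arcs_subset:
  assumes "orbital_digraph K Y"
  shows "parcs Y \<subseteq> pverts K \<times> pverts K"
  by (auto elim!: orbital_digraph_arcE[OF assms] dest!: orbital_subset_vertices)

lemma (in group) right_mult_cay_hom:
  assumes C: "C \<subseteq> carrier G" and g: "g \<in> carrier G"
  shows "(\<lambda>x. x \<otimes> g) \<in> digraph_hom (cay G C) (cay G C)"
proof -
  have "(b \<otimes> g) \<otimes> inv (a \<otimes> g) = b \<otimes> inv a" if "a \<in> carrier G" "b \<in> carrier G" for a b
    using that g by (simp add: inv_mult_group m_assoc inv_solve_left)
      (simp flip: m_assoc)
  then show ?thesis
    using g by (auto simp: digraph_hom_def cay_def)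
qed

lemma digraph_hom_comp:
  assumes "f \<in> digraph_hom X Y" and "g \<in> digraph_hom Y Z"
  shows "g \<circ> f \<in> digraph_hom X Z"
  using assms by (fastforce simp: digraph_hom_def)

text \<open>
  The connection set of the largest right-invariant digraph on the group that \<open>\<phi>\<close> maps into \<open>Y\<close>.
\<close>

definition invariant_pullback ::
  "('a, 'm) monoid_scheme \<Rightarrow> ('a \<Rightarrow> 'b) \<Rightarrow> 'b pair_pre_digraph \<Rightarrow> 'a set" where
  "invariant_pullback G \<phi> Y =
    {c \<in> carrier G. \<forall>g \<in> carrier G. (\<phi> g, \<phi> (c \<otimes>\<^bsub>G\<^esub> g)) \<in> parcs Y}"

context group
begin

lemma cay_invariant_pullback_arcs:
  "parcs (cay G (invariant_pullback G \<phi> Y)) =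
    {(a, b). a \<in> carrier G \<and> b \<in> carrier G \<and>
      (\<forall>g \<in> carrier G. (\<phi> (a \<otimes> g), \<phi> (b \<otimes> g)) \<in> parcs Y)}"
proof -
  have "(\<forall>g \<in> carrier G. (\<phi> g, \<phi> (b \<otimes> inv a \<otimes> g)) \<in> parcs Y) \<longleftrightarrow>
      (\<forall>g \<in> carrier G. (\<phi> (a \<otimes> g), \<phi> (b \<otimes> g)) \<in> parcs Y)" (is "?L \<longleftrightarrow> ?R")
    if a: "a \<in> carrier G" and b: "b \<in> carrier G" for a b
  proof
    assume L: ?L
    show ?R
    proof
      fix g assume g: "g \<in> carrier G"
      have "b \<otimes> inv a \<otimes> (a \<otimes> g) = b \<otimes> g"
        using a b g by (metis inv_closed inv_solve_right m_assoc m_closed)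
      then show "(\<phi> (a \<otimes> g), \<phi> (b \<otimes> g)) \<in> parcs Y"
        using L a g by (metis m_closed)
    qed
  next
    assume R: ?R
    show ?L
    proof
      fix g assume g: "g \<in> carrier G"
      have "a \<otimes> (inv a \<otimes> g) = g"
        using a g by (simp flip: m_assoc)
      then show "(\<phi> g, \<phi> (b \<otimes> inv a \<otimes> g)) \<in> parcs Y"
        using R a b g by (metis inv_closed m_assoc m_closed)
    qed
  qed
  then show ?thesis
    by (auto simp: cay_def invariant_pullback_def)
qed

lemma cay_invariant_pullback_hom:
  assumes "\<phi> \<in> carrier G \<rightarrow> pverts Y"
  shows "\<phi> \<in> digraph_hom (cay G (invariant_pullback G \<phi> Y)) Y"
proof -
  have "(\<phi> a, \<phi> b) \<in> parcs Y" if "(a, b) \<in> parcs (cay G (invariant_pullback G \<phi> Y))" for a b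
    using that unfolding cay_invariant_pullback_arcs by (auto dest!: bspec[OF _ one_closed])
  then show ?thesis
    using assms by (auto simp: digraph_hom_def cay_def)
qed

lemma invariant_pullback_inv_closed:
  assumes sym: "sym (parcs Y)" and c: "c \<in> invariant_pullback G \<phi> Y"
  shows "inv c \<in> invariant_pullback G \<phi> Y"
proof -
  have cG: "c \<in> carrier G"
    using c by (simp add: invariant_pullback_def)
  have "(\<phi> g, \<phi> (inv c \<otimes> g)) \<in> parcs Y" if g: "g \<in> carrier G" for g
  proof -
    have "(\<phi> (inv c \<otimes> g), \<phi> (c \<otimes> (inv c \<otimes> g))) \<in> parcs Y"
      using c cG g by (simp add: invariant_pullback_def)
    moreover have "c \<otimes> (inv c \<otimes> g) = g"
      using cG g by (simp flip: m_assoc)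
    ultimately show ?thesis
      using sym by (auto dest: symD)
  qed
  then show ?thesis
    using cG by (simp add: invariant_pullback_def)
qed

lemma one_notin_invariant_pullback:
  assumes "\<And>u. (u, u) \<notin> parcs Y"
  shows "\<one> \<notin> invariant_pullback G \<phi> Y"
  using assms by (auto simp: invariant_pullback_def)

text \<open>
  The maps \<open>\<iota>\<close> and \<open>\<phi>\<close> that exhibit \<open>K\<close> as the core of a Cayley digraph also exhibit the
  homomorphic equivalence of \<open>Y\<close> with the Cayley digraph of its invariant pullback.
\<close>

lemma hom_equivalent_cay_invariant_pullback:
  assumes C: "C \<subseteq> carrier G" and core: "is_core K"
    and \<iota>: "\<iota> \<in> digraph_hom K (cay G C)" and \<phi>: "\<phi> \<in> digraph_hom (cay G C) K"
    and Y: "orbital_digraph K Y"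
  shows "hom_equivalent Y (cay G (invariant_pullback G \<phi> Y))"
proof -
  have verts: "pverts Y = pverts K"
    using Y by (simp add: orbital_digraph_def)
  have \<iota>_carrier: "\<iota> u \<in> carrier G" if "u \<in> pverts K" for u
    using \<iota> that by (auto simp: digraph_hom_def cay_def)
  have "(\<phi> (\<iota> u \<otimes> g), \<phi> (\<iota> v \<otimes> g)) \<in> parcs Y"
    if uv: "(u, v) \<in> parcs Y" and g: "g \<in> carrier G" for u v g
  proof -
    let ?\<alpha> = "\<phi> \<circ> ((\<lambda>x. x \<otimes> g) \<circ> \<iota>)"
    have "?\<alpha> \<in> digraph_hom K K"
      using \<iota> right_mult_cay_hom[OF C g] \<phi> by (blast intro: digraph_hom_comp)
    with core have "restrict ?\<alpha> (pverts K) \<in> digraph_auto K"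
      by (rule core_endomorphism_is_automorphism)
    then have "(restrict ?\<alpha> (pverts K) u, restrict ?\<alpha> (pverts K) v) \<in> parcs Y"
      using uv by (rule orbital_digraph_invariant[OF Y])
    moreover have "u \<in> pverts K" "v \<in> pverts K"
      using uv orbital_digraph_arcs_subset[OF Y] by auto
    ultimately show ?thesis
      by simp
  qed
  then have "\<iota> \<in> digraph_hom Y (cay G (invariant_pullback G \<phi> Y))"
    using \<iota>_carrier orbital_digraph_arcs_subset[OF Y] verts
    unfolding digraph_hom_def cay_invariant_pullback_arcs by (auto simp: cay_def)
  moreover have "\<phi> \<in> digraph_hom (cay G (invariant_pullback G \<phi> Y)) Y"
    using \<phi> verts by (intro cay_invariant_pullback_hom) (simp add: digraph_hom_def cay_def)
  ultimately show ?thesis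
    by (auto simp: hom_equivalent_def)
qed

end

theorem corollary6p2:
  fixes \<Gamma> :: "('a, 'm) monoid_scheme"
    and X :: "'a pair_pre_digraph"
    and K :: "'b pair_pre_digraph"
  assumes "group \<Gamma>" and "finite (carrier \<Gamma>)"
    and "cayley_digraph_for \<Gamma> X"
    and "core_of K X"
  shows "(\<forall>Y. orbital_digraph K Y \<longrightarrow> (\<exists>Z. cayley_digraph_for \<Gamma> Z \<and> hom_equivalent Y Z)) \<and>
         (\<forall>Y. orbital_graph K Y \<longrightarrow> (\<exists>Z. cayley_graph_for \<Gamma> Z \<and> hom_equivalent Y Z))"
proof -
  interpret group \<Gamma> by (fact assms(1))
  obtain C where C: "C \<subseteq> carrier \<Gamma>" and X: "X = cay \<Gamma> C"
    using assms(3) by (auto simp: cayley_digraph_for_def)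
  have core: "is_core K"
    using assms(4) by (simp add: core_of_def)
  obtain \<iota> \<phi> where \<iota>: "\<iota> \<in> digraph_hom K (cay \<Gamma> C)" and \<phi>: "\<phi> \<in> digraph_hom (cay \<Gamma> C) K"
    using assms(4) X by (auto simp: core_of_def hom_equivalent_def)
  let ?D = "invariant_pullback \<Gamma> \<phi>"
  have subset: "?D Y \<subseteq> carrier \<Gamma>" for Y
    by (auto simp: invariant_pullback_def)
  have equiv: "hom_equivalent Y (cay \<Gamma> (?D Y))" if "orbital_digraph K Y" for Y
    using C core \<iota> \<phi> that by (rule hom_equivalent_cay_invariant_pullback)
  show ?thesis
  proof (intro conjI allI impI)
    fix Y assume "orbital_digraph K Y"
    moreover have "cayley_digraph_for \<Gamma> (cay \<Gamma> (?D Y))"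
      using subset by (auto simp: cayley_digraph_for_def)
    ultimately show "\<exists>Z. cayley_digraph_for \<Gamma> Z \<and> hom_equivalent Y Z"
      using equiv by blast
  next
    fix Y assume "orbital_graph K Y"
    then have Y: "orbital_digraph K Y" and sym: "sym (parcs Y)"
      by (auto simp: orbital_graph_def)
    have "\<forall>c \<in> ?D Y. inv\<^bsub>\<Gamma>\<^esub> c \<in> ?D Y"
      using invariant_pullback_inv_closed[OF sym] by blast
    moreover have "\<one>\<^bsub>\<Gamma>\<^esub> \<notin> ?D Y"
      using orbital_digraph_loopless[OF Y] by (rule one_notin_invariant_pullback)
    ultimately have "cayley_graph_for \<Gamma> (cay \<Gamma> (?D Y))"
      unfolding cayley_graph_for_def using subset by (intro exI[of _ "?D Y"]) simp
    then show "\<exists>Z. cayley_graph_for \<Gamma> Z \<and> hom_equivalent Y Z"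
      using equiv[OF Y] by blast
  qed
qed

end
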